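(* Let $X$ and $Y$ be nonzero real Banach spaces, $N$ an absolute normalized norm on $\mathbb{R}^2$, and $a,b\geq 0$ with $N(a,b) = 1$. Given $x \in B_X$ and $y \in B_Y$, we have (in $X\oplus_N Y$) $$\delta c((ax,by)) \geq \min \{ \delta c(x), \delta c(y)\}.$$ Moreover: (a) if $b=0$, then $\delta c((x,0)) \geq \delta c(x)$; (b) if $a=0$, then $\delta c((0,y)) \geq \delta c(y)$.
   Context: A norm $N$ on $\mathbb{R}^2$ is absolute if $N(a,b)=N(|a|,|b|)$ for all $(a,b)$, and normalized if $N(1,0)=N(0,1)=1$. $X\oplus_N Y$ is $X\times Y$ with norm $\|(x,y)\|_N=N(\|x\|,\|y\|)$. For a Banach space $Z$, $B_Z$, $S_Z$, $Z^*$ denote the closed unit ball, unit sphere and topological dual. A slice of $B_Z$ is a set $S(z^*,\delta)=\{w\in B_Z : z^*(w)>1-\delta\}$ with $z^*\in S_{Z^*}$ and $\delta>0$. For $z\in B_Z$, the $\Delta$-constant $\delta c(z)$ (computed in the space $Z$ in which $z$ lies) is the supremum of all $\alpha\ge 0$ such that for all $\varepsilon,\delta>0$ and all $z^*\in S_{Z^*}$ with $z\in S(z^*,\delta)$ there exists $w\in S(z^*,\delta)$ with $\|w-z\|>\alpha-\varepsilon$. *)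

theory Defs
  imports "HOL-Analysis.Analysis"
begin

text \<open>
  The norm is an explicit parameter of the notions below: the type \<^typ>\<open>'a \<times> 'b\<close> already
  carries the Euclidean product norm as its class norm, whereas the sum norm depends on \<open>N\<close>.
  For a space \<open>X\<close> with its own norm the parameter is instantiated with \<^const>\<open>norm\<close>.
\<close>

definition is_norm :: "('v::real_vector \<Rightarrow> real) \<Rightarrow> bool" where
  "is_norm nrm \<longleftrightarrow>
     (\<forall>v. nrm v = 0 \<longleftrightarrow> v = 0) \<and>
     (\<forall>c v. nrm (c *\<^sub>R v) = \<bar>c\<bar> * nrm v) \<and>
     (\<forall>u v. nrm (u + v) \<le> nrm u + nrm v)"

definition absolute_norm :: "(real \<times> real \<Rightarrow> real) \<Rightarrow> bool" where
  "absolute_norm N \<longleftrightarrow> is_norm N \<and> (\<forall>a b. N (a, b) = N (\<bar>a\<bar>, \<bar>b\<bar>))"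

definition normalized :: "(real \<times> real \<Rightarrow> real) \<Rightarrow> bool" where
  "normalized N \<longleftrightarrow> N (1, 0) = 1 \<and> N (0, 1) = 1"

definition sum_norm ::
    "(real \<times> real \<Rightarrow> real) \<Rightarrow> 'a::real_normed_vector \<times> 'b::real_normed_vector \<Rightarrow> real" where
  "sum_norm N z = N (norm (fst z), norm (snd z))"

definition unit_ball :: "('z::real_vector \<Rightarrow> real) \<Rightarrow> 'z set" where
  "unit_ball nrm = {w. nrm w \<le> 1}"

text \<open>
  The unit sphere of the topological dual. Boundedness on the unit ball is continuity; it also
  makes the supremum, which is the dual norm, a genuine one.
\<close>

definition dual_sphere :: "('z::real_vector \<Rightarrow> real) \<Rightarrow> ('z \<Rightarrow> real) set" where
  "dual_sphere nrm =
     {f. linear f \<and> bdd_above ((\<lambda>w. \<bar>f w\<bar>) ` unit_ball nrm) \<and>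
         (SUP w\<in>unit_ball nrm. \<bar>f w\<bar>) = 1}"

definition slice :: "('z::real_vector \<Rightarrow> real) \<Rightarrow> ('z \<Rightarrow> real) \<Rightarrow> real \<Rightarrow> 'z set" where
  "slice nrm f \<delta> = {w \<in> unit_ball nrm. f w > 1 - \<delta>}"

text \<open>
  The supremum is taken in \<^typ>\<open>ereal\<close>, where it always exists. For \<open>z\<close> in the unit ball of a
  nonzero space the set lies in \<open>[0, 2]\<close> and contains \<open>0\<close>, so the value is then the real
  supremum.
\<close>

definition delta_const :: "('z::real_vector \<Rightarrow> real) \<Rightarrow> 'z \<Rightarrow> ereal" where
  "delta_const nrm z =
     Sup {ereal \<alpha> | \<alpha>. \<alpha> \<ge> 0 \<and>
       (\<forall>\<epsilon>>0. \<forall>\<delta>>0. \<forall>f\<in>dual_sphere nrm. z \<in> slice nrm f \<delta> \<longrightarrow>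
          (\<exists>w\<in>slice nrm f \<delta>. nrm (w - z) > \<alpha> - \<epsilon>))}"

lemma unit_ball_norm: "unit_ball norm = cball (0 :: 'a::real_normed_vector) 1"
  by (auto simp: unit_ball_def)

lemma dual_sphere_norm:
  "dual_sphere (norm :: 'a::real_normed_vector \<Rightarrow> real) = {f. bounded_linear f \<and> onorm f = 1}"
proof -
  have bl: "bounded_linear f"
    if "linear f" and bdd: "bdd_above ((\<lambda>w. \<bar>f w\<bar>) ` unit_ball norm)" for f :: "'a \<Rightarrow> real"
  proof -
    interpret f: linear f by fact
    obtain K where K: "\<And>w. norm w \<le> 1 \<Longrightarrow> \<bar>f w\<bar> \<le> K"
      using bdd by (auto simp: bdd_above_def unit_ball_def)
    have "norm (f x) \<le> norm x * K" for x
    proof (cases "x = 0")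
      case False
      have "\<bar>f ((1 / norm x) *\<^sub>R x)\<bar> \<le> K"
        by (rule K) (use False in simp)
      then show ?thesis
        using False by (simp add: f.scaleR abs_mult field_simps)
    qed (simp add: f.zero)
    then show ?thesis
      by (intro bounded_linear_intro[where K = K]) (auto simp: f.add f.scaleR)
  qed
  have bdd: "bdd_above ((\<lambda>w. \<bar>f w\<bar>) ` unit_ball norm)"
    and on: "(SUP w\<in>unit_ball norm. \<bar>f w\<bar>) = onorm f"
    if f: "bounded_linear f" for f :: "'a \<Rightarrow> real"
  proof -
    interpret f: bounded_linear f by fact
    have le: "\<bar>f w\<bar> \<le> onorm f" if "w \<in> unit_ball norm" for w
      using onorm[OF f, of w] mult_left_mono[of "norm w" 1 "onorm f"] onorm_pos_le[OF f] that
      by (auto simp: unit_ball_def)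
    then show bdd: "bdd_above ((\<lambda>w. \<bar>f w\<bar>) ` unit_ball norm)"
      by (intro bdd_aboveI2)
    have ne: "unit_ball (norm :: 'a \<Rightarrow> real) \<noteq> {}"
      by (auto simp: unit_ball_def intro: exI[of _ 0])
    have "onorm f \<le> (SUP w\<in>unit_ball norm. \<bar>f w\<bar>)"
    proof (rule onorm_bound)
      show "0 \<le> (SUP w\<in>unit_ball norm. \<bar>f w\<bar>)"
        using cSUP_upper[OF _ bdd, of 0] by (simp add: unit_ball_def f.zero)
    next
      fix x
      show "norm (f x) \<le> (SUP w\<in>unit_ball norm. \<bar>f w\<bar>) * norm x"
      proof (cases "x = 0")
        case False
        have "\<bar>f ((1 / norm x) *\<^sub>R x)\<bar> \<le> (SUP w\<in>unit_ball norm. \<bar>f w\<bar>)"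
          by (rule cSUP_upper[OF _ bdd]) (use False in \<open>simp add: unit_ball_def\<close>)
        then show ?thesis
          using False by (simp add: f.scaleR abs_mult field_simps)
      qed (simp add: f.zero)
    qed
    moreover have "(SUP w\<in>unit_ball norm. \<bar>f w\<bar>) \<le> onorm f"
      by (rule cSUP_least[OF ne le])
    ultimately show "(SUP w\<in>unit_ball norm. \<bar>f w\<bar>) = onorm f" by simp
  qed
  show ?thesis
    using bl bdd on unfolding dual_sphere_def by (auto simp: bounded_linear.linear)
qed

lemma absolute_norm_mono:
  assumes N: "absolute_norm N" and "0 \<le> a" "a \<le> a'" "0 \<le> b" "b \<le> b'"
  shows "N (a, b) \<le> N (a', b')"
proof -
  have tri: "N (u + v) \<le> N u + N v" and hom: "N (c *\<^sub>R v) = \<bar>c\<bar> * N v"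
    and ab: "N (p, q) = N (\<bar>p\<bar>, \<bar>q\<bar>)" for u v c p q
    using N unfolding absolute_norm_def is_norm_def by blast+
  have fst_mono: "N (s, q) \<le> N (t, q)" if "0 \<le> s" "s \<le> t" for s t q
  proof (cases "t = 0")
    case False
    define l where "l = (1 + s / t) / 2"
    have l: "0 \<le> l" "l \<le> 1" using that False by (auto simp: l_def field_simps)
    have "(s, q) = l *\<^sub>R (t, q) + (1 - l) *\<^sub>R (- t, q)"
      using False by (simp add: l_def field_simps)
    then have "N (s, q) \<le> l * N (t, q) + (1 - l) * N (- t, q)"
      using tri[of "l *\<^sub>R (t, q)" "(1 - l) *\<^sub>R (- t, q)"] l unfolding hom by simp
    also have "N (- t, q) = N (t, q)" using ab[of "- t" q] ab[of t q] by simp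
    finally show ?thesis by (simp add: algebra_simps)
  qed (use that in simp)
  have snd_mono: "N (p, s) \<le> N (p, t)" if "0 \<le> s" "s \<le> t" for s t p
  proof (cases "t = 0")
    case False
    define l where "l = (1 + s / t) / 2"
    have l: "0 \<le> l" "l \<le> 1" using that False by (auto simp: l_def field_simps)
    have "(p, s) = l *\<^sub>R (p, t) + (1 - l) *\<^sub>R (p, - t)"
      using False by (simp add: l_def field_simps)
    then have "N (p, s) \<le> l * N (p, t) + (1 - l) * N (p, - t)"
      using tri[of "l *\<^sub>R (p, t)" "(1 - l) *\<^sub>R (p, - t)"] l unfolding hom by simp
    also have "N (p, - t) = N (p, t)" using ab[of p "- t"] ab[of p t] by simp
    finally show ?thesis by (simp add: algebra_simps)
  qed (use that in simp)
  show ?thesis using fst_mono[of a a' b] snd_mono[of b b' a'] assms by simp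
qed

lemma is_norm_sum_norm:
  assumes N: "absolute_norm N"
  shows "is_norm (sum_norm N :: 'a::real_normed_vector \<times> 'b::real_normed_vector \<Rightarrow> real)"
proof -
  have tri: "N (u + v) \<le> N u + N v" and hom: "N (c *\<^sub>R v) = \<bar>c\<bar> * N v"
    and zero: "N v = 0 \<longleftrightarrow> v = 0" for u v c
    using N unfolding absolute_norm_def is_norm_def by blast+
  have "sum_norm N (u + v) \<le> sum_norm N u + sum_norm N v" for u v :: "'a \<times> 'b"
  proof -
    have "sum_norm N (u + v) \<le> N (norm (fst u) + norm (fst v), norm (snd u) + norm (snd v))"
      unfolding sum_norm_def by (rule absolute_norm_mono[OF N]) (auto intro: norm_triangle_ineq)
    also have "\<dots> \<le> sum_norm N u + sum_norm N v"
      using tri[of "(norm (fst u), norm (snd u))" "(norm (fst v), norm (snd v))"]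
      by (simp add: sum_norm_def)
    finally show ?thesis .
  qed
  moreover have "sum_norm N (c *\<^sub>R v) = \<bar>c\<bar> * sum_norm N v" for c and v :: "'a \<times> 'b"
    using hom[of c "(norm (fst v), norm (snd v))"] hom[of "\<bar>c\<bar>" "(norm (fst v), norm (snd v))"]
    by (simp add: sum_norm_def)
  moreover have "sum_norm N v = 0 \<longleftrightarrow> v = 0" for v :: "'a \<times> 'b"
    by (simp add: sum_norm_def zero prod_eq_iff)
  ultimately show ?thesis unfolding is_norm_def by blast
qed

end

theory Submission imports Defs begin

text \<open>
  Let \<open>f\<close> be a norm-one functional on the sum whose slice contains \<open>(a x, b y)\<close>. Moving \<open>x\<close> and \<open>y\<close>
  separately to points \<open>u\<close> and \<open>v\<close> of the respective balls at distance almost \<open>\<alpha>\<close>, while the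
  two restrictions of \<open>f\<close> decrease arbitrarily little, yields a point \<open>(a u, b v)\<close> of the same slice
  whose distance to \<open>(a x, b y)\<close> is at least \<open>\<alpha> N(a, b) = \<alpha>\<close> up to \<open>\<epsilon>\<close>. If a restriction
  of \<open>f\<close> vanishes, then it gives no slice of its own, and a norm-one functional comes from the
  Hahn-Banach theorem instead.
\<close>

section \<open>Existence of norm-one functionals\<close>

definition sublinear :: "('v::real_vector \<Rightarrow> real) \<Rightarrow> bool" where
  "sublinear p \<longleftrightarrow> (\<forall>x y. p (x + y) \<le> p x + p y) \<and> (\<forall>c x. 0 \<le> c \<longrightarrow> p (c *\<^sub>R x) = c * p x)"

text \<open>One half of positive homogeneity suffices: the inequality at \<open>inverse c\<close>
  and \<open>c *\<^sub>R x\<close> is the reverse inequality at \<open>c\<close> and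
  \<open>x\<close>.\<close>

lemma sublinearI:
  assumes "\<And>x y. p (x + y) \<le> p x + p y" and "\<And>c x. 0 < c \<Longrightarrow> p (c *\<^sub>R x) \<le> c * p x" and "p 0 = 0"
  shows "sublinear p"
proof -
  have "p (c *\<^sub>R x) = c * p x" if "0 \<le> c" for c x
  proof (cases "c = 0")
    case False
    with that have c: "0 < c" by simp
    have "p (inverse c *\<^sub>R (c *\<^sub>R x)) \<le> inverse c * p (c *\<^sub>R x)"
      using c by (intro assms(2)) simp
    with c have "c * p x \<le> p (c *\<^sub>R x)" by (simp add: field_simps)
    with assms(2)[OF c, of x] show ?thesis by simp
  qed (simp add: assms(3))
  with assms(1) show ?thesis by (auto simp: sublinear_def)
qed

lemma sublinear_0: "sublinear p \<Longrightarrow> p 0 = 0"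
  unfolding sublinear_def by (metis mult_zero_left order_refl scaleR_zero_left)

lemma sublinear_add: "sublinear p \<Longrightarrow> p (x + y) \<le> p x + p y"
  by (simp add: sublinear_def)

lemma sublinear_scaleR: "sublinear p \<Longrightarrow> 0 \<le> c \<Longrightarrow> p (c *\<^sub>R x) = c * p x"
  by (simp add: sublinear_def)

lemma sublinear_minus_ge: "sublinear p \<Longrightarrow> - p (- x) \<le> p x"
  using sublinear_add[of p x "- x"] sublinear_0[of p] by simp

text \<open>Serves both for the shifts below and for chains in Zorn's lemma. The index
  \<open>k\<close> may differ from \<open>i\<close> and \<open>j\<close>: shifts need the sum of two
  parameters, chains the smaller of two members.\<close>

lemma sublinear_INF:
  assumes I: "I \<noteq> {}" and bdd: "\<And>x. bdd_below ((\<lambda>i. p i x) ` I)"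
    and add: "\<And>i j x y. i \<in> I \<Longrightarrow> j \<in> I \<Longrightarrow> \<exists>k\<in>I. p k (x + y) \<le> p i x + p j y"
    and scale: "\<And>i c x. i \<in> I \<Longrightarrow> 0 < c \<Longrightarrow> \<exists>k\<in>I. p k (c *\<^sub>R x) \<le> c * p i x"
    and zero: "\<And>i. i \<in> I \<Longrightarrow> p i 0 = 0"
  shows "sublinear (\<lambda>x. INF i\<in>I. p i x)"
proof (rule sublinearI)
  fix x y
  have "(INF i\<in>I. p i (x + y)) - p i x \<le> (INF i\<in>I. p i y)" if i: "i \<in> I" for i
  proof (rule cINF_greatest[OF I])
    fix j assume "j \<in> I"
    with add[OF i this, of x y] obtain k where "k \<in> I" "p k (x + y) \<le> p i x + p j y" by blast
    with cINF_lower[OF bdd, of k "x + y"] show "(INF i\<in>I. p i (x + y)) - p i x \<le> p j y" by simp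
  qed
  then have "(INF i\<in>I. p i (x + y)) - (INF i\<in>I. p i y) \<le> (INF i\<in>I. p i x)"
    by (intro cINF_greatest[OF I]) (simp add: algebra_simps)
  then show "(INF i\<in>I. p i (x + y)) \<le> (INF i\<in>I. p i x) + (INF i\<in>I. p i y)" by simp
next
  fix c :: real and x assume c: "0 < c"
  have "(INF i\<in>I. p i (c *\<^sub>R x)) / c \<le> (INF i\<in>I. p i x)"
  proof (rule cINF_greatest[OF I])
    fix i assume "i \<in> I"
    with scale[OF this c, of x] obtain k where "k \<in> I" "p k (c *\<^sub>R x) \<le> c * p i x" by blast
    with cINF_lower[OF bdd, of k "c *\<^sub>R x"] c show "(INF i\<in>I. p i (c *\<^sub>R x)) / c \<le> p i x"
      by (simp add: field_simps)
  qed
  with c show "(INF i\<in>I. p i (c *\<^sub>R x)) \<le> c * (INF i\<in>I. p i x)" by (simp add: field_simps)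
next
  have "(INF i\<in>I. p i 0) = (INF i\<in>I. 0 :: real)"
    by (rule INF_cong) (auto simp: zero)
  with I show "(INF i\<in>I. p i 0) = 0" by simp
qed

text \<open>The infimum over \<open>t \<ge> 0\<close> of
  \<open>p (x + t *\<^sub>R y) - t * p y\<close> works: \<open>t = 0\<close> and
  \<open>t = 1\<close> give the two bounds. When \<open>q = p\<close>, the last bound says that
  \<open>p\<close> is superadditive.\<close>

lemma sublinear_shift:
  assumes p: "sublinear p"
  obtains q where "sublinear q" "q \<le> p" "\<And>x. q x \<le> p (x + y) - p y"
proof -
  define r where "r t x = p (x + t *\<^sub>R y) - t * p y" for t x
  have bdd: "bdd_below ((\<lambda>t. r t x) ` {0..})" for x
  proof (rule bdd_belowI2)
    fix t :: real assume "t \<in> {0..}"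
    \<comment> \<open>Subadditivity for \<open>t *\<^sub>R y = (x + t *\<^sub>R y) + (- x)\<close>
      gives a lower bound independent of \<open>t\<close>.\<close>
    then show "- p (- x) \<le> r t x"
      using sublinear_add[OF p, of "x + t *\<^sub>R y" "- x"] sublinear_scaleR[OF p, of t y]
      by (simp add: r_def)
  qed
  define q where "q x = (INF t\<in>{0..}. r t x)" for x
  have "sublinear q" unfolding q_def
  proof (rule sublinear_INF[OF _ bdd])
    fix s t :: real and x z assume "s \<in> {0..}" "t \<in> {0..}"
    then show "\<exists>k\<in>{0..}. r k (x + z) \<le> r s x + r t z"
      using sublinear_add[OF p, of "x + s *\<^sub>R y" "z + t *\<^sub>R y"]
      by (intro bexI[of _ "s + t"]) (auto simp: r_def algebra_simps)
  next
    fix c t :: real and x assume "t \<in> {0..}" "0 < c"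
    then show "\<exists>k\<in>{0..}. r k (c *\<^sub>R x) \<le> c * r t x"
      using sublinear_scaleR[OF p, of c "x + t *\<^sub>R y"]
      by (intro bexI[of _ "c * t"]) (auto simp: r_def algebra_simps)
  qed (auto simp: r_def sublinear_scaleR[OF p])
  moreover have q_le: "q x \<le> r t x" if "0 \<le> t" for t x
    unfolding q_def using that by (intro cINF_lower bdd) simp
  have "q \<le> p" using q_le[of 0] by (simp add: le_fun_def r_def)
  moreover have "q x \<le> p (x + y) - p y" for x using q_le[of 1 x] by (simp add: r_def)
  ultimately show ?thesis using that by blast
qed

text \<open>
  A minimal sublinear functional is linear, since it cannot be lowered by \<open>sublinear_shift\<close>.
\<close>

lemma linear_below_sublinear:
  assumes p: "sublinear p"
  obtains f where "linear f" "f \<le> p"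
proof -
  define A where "A = {q. sublinear q \<and> q \<le> p}"
  define R where "R = relation_of (\<ge>) A"
  \<comment> \<open>Zorn's lemma for the reversed order: a nonempty chain is bounded by its
    pointwise infimum, which \<open>- p (- x)\<close> keeps finite.\<close>
  have "\<exists>m\<in>A. \<forall>q\<in>A. m \<ge> q \<longrightarrow> q = m"
  proof (rule predicate_Zorn)
    show "partial_order_on A (relation_of (\<ge>) A)"
      by (rule partial_order_on_relation_ofI) auto
  next
    fix C assume C: "C \<in> Chains (relation_of (\<ge>) A)"
    then have CA: "q \<in> A" if "q \<in> C" for q
      using that by (auto simp: Chains_def relation_of_def)
    have total: "q \<le> r \<or> r \<le> q" if "q \<in> C" "r \<in> C" for q r
      using C that by (auto simp: Chains_def relation_of_def)
    show "\<exists>u\<in>A. \<forall>q\<in>C. q \<ge> u"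
    proof (cases "C = {}")
      case True
      with p show ?thesis by (auto simp: A_def)
    next
      case False
      have bdd: "bdd_below ((\<lambda>q. q x) ` C)" for x
      proof (rule bdd_belowI2)
        fix q assume "q \<in> C"
        with CA have "sublinear q" "q (- x) \<le> p (- x)" by (auto simp: A_def le_fun_def)
        with sublinear_minus_ge[of q x] show "- p (- x) \<le> q x" by simp
      qed
      have "sublinear (\<lambda>x. INF q\<in>C. q x)"
      proof (rule sublinear_INF[OF False bdd])
        fix q r x y assume qr: "q \<in> C" "r \<in> C"
        then have "q (x + y) \<le> q x + q y" "r (x + y) \<le> r x + r y"
          using CA by (auto simp: A_def intro: sublinear_add)
        \<comment> \<open>The smaller of \<open>q\<close> and \<open>r\<close> is the member
          \<open>s\<close> sought.\<close>
        moreover from total[OF qr] have "q y \<le> r y \<or> r x \<le> q x" by (auto simp: le_fun_def)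
        ultimately have "q (x + y) \<le> q x + r y \<or> r (x + y) \<le> q x + r y" by linarith
        with qr show "\<exists>s\<in>C. s (x + y) \<le> q x + r y" by blast
      next
        fix q c x assume "q \<in> C" "0 < (c :: real)"
        then have "q (c *\<^sub>R x) = c * q x" using CA by (simp add: A_def sublinear_scaleR)
        with \<open>q \<in> C\<close> show "\<exists>s\<in>C. s (c *\<^sub>R x) \<le> c * q x" by (intro bexI[of _ q]) simp
      next
        show "q 0 = 0" if "q \<in> C" for q using CA[OF that] by (simp add: A_def sublinear_0)
      qed
      moreover have le: "(\<lambda>x. INF q\<in>C. q x) \<le> q" if "q \<in> C" for q
        unfolding le_fun_def using cINF_lower[OF bdd that] by simp
      moreover from False obtain q where "q \<in> C" by blast
      with le CA have "(\<lambda>x. INF q\<in>C. q x) \<le> p" by (fastforce simp: A_def intro: order.trans)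
      ultimately show ?thesis by (auto simp: A_def)
    qed
  qed
  then obtain m where m: "sublinear m" "m \<le> p" and min: "\<And>q. sublinear q \<Longrightarrow> q \<le> m \<Longrightarrow> q = m"
    unfolding A_def by (blast intro: order.trans)
  have add: "m (x + y) = m x + m y" for x y
  proof -
    obtain q where "sublinear q" "q \<le> m" and q: "\<And>x. q x \<le> m (x + y) - m y"
      using sublinear_shift[OF m(1), of y] by blast
    with min have "q = m" by blast
    \<comment> \<open>Now \<open>q = m\<close> turns the bound on \<open>q\<close> into
      \<open>m x + m y \<le> m (x + y)\<close>.\<close>
    with q[of x] sublinear_add[OF m(1), of x y] show ?thesis by simp
  qed
  have minus: "m (- x) = - m x" for x
    using add[of x "- x"] sublinear_0[OF m(1)] by simp
  have "m (c *\<^sub>R x) = c * m x" for c x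
    using sublinear_scaleR[OF m(1), of "\<bar>c\<bar>" x] minus[of "c *\<^sub>R x"] by (cases "0 \<le> c") auto
  with add m(2) show ?thesis by (intro that[of m] linearI) auto
qed

lemma onorm_normalize:
  fixes f :: "'a::real_normed_vector \<Rightarrow> real"
  assumes "bounded_linear f" "onorm f \<noteq> 0"
  shows "(\<lambda>x. f x / onorm f) \<in> dual_sphere norm"
  using assms onorm_scaleR[OF assms(1), of "inverse (onorm f)"] onorm_pos_le[OF assms(1)]
    bounded_linear_const_scaleR[OF assms(1), of "inverse (onorm f)"]
  by (simp add: dual_sphere_norm divide_inverse mult.commute)

text \<open>A linear functional below the norm could be zero. Shifting the norm by some
  \<open>y \<noteq> 0\<close> first forces \<open>f (- y) \<le> - norm y\<close>, so
  \<open>f\<close> is nonzero and can be normalized.\<close>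

lemma dual_sphere_nonempty:
  assumes "(UNIV :: 'a::real_normed_vector set) \<noteq> {0}"
  shows "dual_sphere (norm :: 'a \<Rightarrow> real) \<noteq> {}"
proof -
  from assms obtain y :: 'a where y: "y \<noteq> 0" by auto
  have "sublinear (norm :: 'a \<Rightarrow> real)"
    by (intro sublinearI) (auto intro: norm_triangle_ineq)
  then obtain q where q: "sublinear q" "q \<le> norm" "\<And>x. q x \<le> norm (x + y) - norm y"
    using sublinear_shift[of "norm :: 'a \<Rightarrow> real" y] by blast
  then obtain f where f: "linear f" "f \<le> q" using linear_below_sublinear by blast
  interpret f: linear f by fact
  have le: "f x \<le> norm x" for x using f(2) q(2) by (meson le_fun_def order.trans)
  have bl: "bounded_linear f"
  proof (rule bounded_linear_intro[where K = 1])
    fix x show "norm (f x) \<le> norm x * 1" using le[of x] le[of "- x"] by (simp add: f.neg abs_le_iff)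
  qed (simp_all add: f.add f.scaleR)
  have "f (- y) \<le> - norm y" using f(2) q(3)[of "- y"] by (auto simp: le_fun_def intro: order.trans)
  with y have "f y \<noteq> 0" by (auto simp: f.neg)
  then have "onorm f \<noteq> 0" using onorm_eq_0[OF bl] by auto
  from onorm_normalize[OF bl this] show ?thesis by blast
qed

section \<open>Points of slices far from a given point\<close>

definition delta_bound :: "('z::real_vector \<Rightarrow> real) \<Rightarrow> 'z \<Rightarrow> real \<Rightarrow> bool" where
  "delta_bound nrm z \<alpha> \<longleftrightarrow>
     (\<forall>\<epsilon>>0. \<forall>\<delta>>0. \<forall>f\<in>dual_sphere nrm. z \<in> slice nrm f \<delta> \<longrightarrow>
        (\<exists>w\<in>slice nrm f \<delta>. nrm (w - z) > \<alpha> - \<epsilon>))"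

lemma delta_const_eq: "delta_const nrm z = Sup {ereal \<alpha> | \<alpha>. \<alpha> \<ge> 0 \<and> delta_bound nrm z \<alpha>}"
  unfolding delta_const_def delta_bound_def ..

text \<open>The condition passes to smaller values, so it holds strictly below the supremum, and
  attainment need not be discussed.\<close>

lemma delta_bound_if_less:
  assumes "ereal t < delta_const nrm z"
  shows "delta_bound nrm z t"
proof -
  from assms obtain \<alpha> where "t < \<alpha>" and \<alpha>: "delta_bound nrm z \<alpha>"
    unfolding delta_const_eq less_Sup_iff by auto
  show ?thesis unfolding delta_bound_def
  proof (intro allI impI ballI)
    fix \<epsilon> \<delta> :: real and f assume "0 < \<epsilon>" "0 < \<delta>" "f \<in> dual_sphere nrm" "z \<in> slice nrm f \<delta>"
    with \<alpha> obtain w where "w \<in> slice nrm f \<delta>" "nrm (w - z) > \<alpha> - \<epsilon>"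
      unfolding delta_bound_def by blast
    with \<open>t < \<alpha>\<close> show "\<exists>w\<in>slice nrm f \<delta>. nrm (w - z) > t - \<epsilon>" by force
  qed
qed

text \<open>For \<open>\<alpha> = 0\<close> the point \<open>z\<close> itself is a witness in every
  slice containing it.\<close>

lemma delta_const_nonneg:
  assumes "nrm 0 = 0"
  shows "0 \<le> delta_const nrm z"
proof -
  have "delta_bound nrm z 0" unfolding delta_bound_def using assms by force
  then show ?thesis unfolding delta_const_eq by (intro Sup_upper) (auto simp: zero_ereal_def)
qed

text \<open>Restates the condition for functionals of arbitrary norm, such as the restrictions of a
  functional on the sum: moving \<open>x\<close> far costs at most \<open>\<eta>\<close> in the
  value of \<open>f\<close>.\<close>

lemma delta_bound_functional:
  fixes x :: "'a::real_normed_vector" and f :: "'a \<Rightarrow> real"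
  assumes ne: "(UNIV :: 'a set) \<noteq> {0}" and x: "norm x \<le> 1" and \<alpha>: "delta_bound norm x \<alpha>"
    and f: "bounded_linear f" and \<epsilon>: "0 < \<epsilon>" and \<eta>: "0 < \<eta>"
  obtains u where "norm u \<le> 1" "f u > f x - \<eta>" "norm (u - x) > \<alpha> - \<epsilon>"
proof -
  interpret f: bounded_linear f by fact
  have *: "\<exists>u. norm u \<le> 1 \<and> g u > g x - \<zeta> \<and> norm (u - x) > \<alpha> - \<epsilon>"
    if g: "g \<in> dual_sphere norm" and \<zeta>: "0 < \<zeta>" for g \<zeta>
  proof -
    \<comment> \<open>The slice to use is cut at level \<open>g x - \<zeta>\<close>, that is,
      \<open>\<delta> = 1 - g x + \<zeta>\<close>; this bound makes \<open>\<delta>\<close>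
      positive.\<close>
    have "g x \<le> 1"
      using onorm[of g x] g x unfolding dual_sphere_norm by auto
    with \<zeta> have "0 < 1 - g x + \<zeta>" by simp
    moreover have "x \<in> slice norm g (1 - g x + \<zeta>)"
      using x \<zeta> by (simp add: slice_def unit_ball_def)
    ultimately obtain u where "u \<in> slice norm g (1 - g x + \<zeta>)" "norm (u - x) > \<alpha> - \<epsilon>"
      using \<alpha> \<epsilon> g unfolding delta_bound_def by blast
    then show ?thesis by (auto simp: slice_def unit_ball_def)
  qed
  show ?thesis
  proof (cases "onorm f = 0")
    case True
    then have "f u = 0" for u using onorm_eq_0[OF f] by simp
    with \<eta> have f_gt: "f u > f x - \<eta>" for u by simp
    obtain g where "g \<in> dual_sphere (norm :: 'a \<Rightarrow> real)"
      using dual_sphere_nonempty[OF ne] by blast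
    \<comment> \<open>Only the distance matters, since \<open>f\<close> vanishes; the loss
      \<open>1\<close> in \<open>g\<close> is an arbitrary choice.\<close>
    with *[of g 1] obtain u where "norm u \<le> 1" "norm (u - x) > \<alpha> - \<epsilon>" by auto
    with f_gt that show ?thesis by blast
  next
    case False
    then have c: "0 < onorm f" using onorm_pos_le[OF f] by simp
    \<comment> \<open>A loss of \<open>\<eta> / onorm f\<close> for the normalized functional is a
      loss of \<open>\<eta>\<close> for \<open>f\<close>.\<close>
    with *[OF onorm_normalize[OF f False], of "\<eta> / onorm f"] \<eta>
    obtain u where "norm u \<le> 1" "f u / onorm f > f x / onorm f - \<eta> / onorm f"
      "norm (u - x) > \<alpha> - \<epsilon>" by auto
    moreover from this(2) c have "f u > f x - \<eta>"
      by (simp add: divide_less_cancel flip: diff_divide_distrib)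
    ultimately show ?thesis using that by blast
  qed
qed

section \<open>The absolute sum\<close>

lemma absolute_norm_fst:
  assumes "absolute_norm N" "normalized N"
  shows "N (c, 0) = \<bar>c\<bar>"
proof -
  have "N (c *\<^sub>R (1, 0)) = \<bar>c\<bar> * N (1, 0)"
    using assms(1) unfolding absolute_norm_def is_norm_def by blast
  with assms(2) show ?thesis by (simp add: normalized_def)
qed

lemma absolute_norm_snd:
  assumes "absolute_norm N" "normalized N"
  shows "N (0, c) = \<bar>c\<bar>"
proof -
  have "N (c *\<^sub>R (0, 1)) = \<bar>c\<bar> * N (0, 1)"
    using assms(1) unfolding absolute_norm_def is_norm_def by blast
  with assms(2) show ?thesis by (simp add: normalized_def)
qed

lemma bounded_linear_if_bdd_above:
  fixes f :: "'a::real_normed_vector \<Rightarrow> real"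
  assumes "linear f" and K: "\<And>w. norm w \<le> 1 \<Longrightarrow> \<bar>f w\<bar> \<le> K"
  shows "bounded_linear f"
proof -
  interpret f: linear f by fact
  have "norm (f x) \<le> norm x * K" for x
  proof (cases "x = 0")
    case False
    have "\<bar>f ((1 / norm x) *\<^sub>R x)\<bar> \<le> K"
      by (rule K) (use False in simp)
    then show ?thesis
      using False by (simp add: f.scaleR abs_mult field_simps)
  qed (simp add: f.zero)
  then show ?thesis
    by (intro bounded_linear_intro[where K = K]) (auto simp: f.add f.scaleR)
qed

text \<open>Both coordinate embeddings are isometric because \<open>N\<close> is normalized, so a
  bound for \<open>f\<close> on the unit ball of the sum also bounds its restrictions.\<close>

lemma dual_sphere_sum_norm_components:
  fixes f :: "'a::real_normed_vector \<times> 'b::real_normed_vector \<Rightarrow> real"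
  assumes N: "absolute_norm N" "normalized N" and f: "f \<in> dual_sphere (sum_norm N)"
  shows "bounded_linear (\<lambda>u. f (u, 0))" "bounded_linear (\<lambda>v. f (0, v))"
proof -
  from f have "linear f" by (simp add: dual_sphere_def)
  then interpret f: linear f .
  from f obtain K where K: "\<And>w. sum_norm N w \<le> 1 \<Longrightarrow> \<bar>f w\<bar> \<le> K"
    unfolding dual_sphere_def bdd_above_def unit_ball_def by auto
  show "bounded_linear (\<lambda>u. f (u, 0))"
  proof (rule bounded_linear_if_bdd_above)
    show "linear (\<lambda>u. f (u, 0))"
    proof (rule linearI)
      show "f (u + v, 0) = f (u, 0) + f (v, 0)" for u v using f.add[of "(u, 0)" "(v, 0)"] by simp
      show "f (c *\<^sub>R u, 0) = c *\<^sub>R f (u, 0)" for c u using f.scaleR[of c "(u, 0)"] by simp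
    qed
    show "\<bar>f (u, 0)\<bar> \<le> K" if "norm u \<le> 1" for u
      using that by (intro K) (simp add: sum_norm_def absolute_norm_fst[OF N])
  qed
  show "bounded_linear (\<lambda>v. f (0, v))"
  proof (rule bounded_linear_if_bdd_above)
    show "linear (\<lambda>v. f (0, v))"
    proof (rule linearI)
      show "f (0, u + v) = f (0, u) + f (0, v)" for u v using f.add[of "(0, u)" "(0, v)"] by simp
      show "f (0, c *\<^sub>R u) = c *\<^sub>R f (0, u)" for c u using f.scaleR[of c "(0, u)"] by simp
    qed
    show "\<bar>f (0, v)\<bar> \<le> K" if "norm v \<le> 1" for v
      using that by (intro K) (simp add: sum_norm_def absolute_norm_snd[OF N])
  qed
qed

text \<open>
  A component of weight zero is not moved, so its \<open>\<Delta>\<close>-constant is irrelevant. This covers the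
  three claims at once.
\<close>

lemma delta_bound_sum_norm:
  fixes x :: "'a::real_normed_vector" and y :: "'b::real_normed_vector"
  assumes neX: "(UNIV :: 'a set) \<noteq> {0}" and neY: "(UNIV :: 'b set) \<noteq> {0}"
    and N: "absolute_norm N" "normalized N"
    and ab: "0 \<le> a" "0 \<le> b" "N (a, b) = 1"
    and x: "norm x \<le> 1" and y: "norm y \<le> 1"
    and \<alpha>x: "a \<noteq> 0 \<Longrightarrow> delta_bound norm x \<alpha>" and \<alpha>y: "b \<noteq> 0 \<Longrightarrow> delta_bound norm y \<alpha>"
  shows "delta_bound (sum_norm N) (a *\<^sub>R x, b *\<^sub>R y) \<alpha>"
  unfolding delta_bound_def
proof (intro allI impI ballI)
  fix \<epsilon> \<delta> :: real and f
  assume \<epsilon>: "0 < \<epsilon>" and f: "f \<in> dual_sphere (sum_norm N)"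
    and z: "(a *\<^sub>R x, b *\<^sub>R y) \<in> slice (sum_norm N) f \<delta>"
  from f have "linear f" by (simp add: dual_sphere_def)
  then interpret f: linear f .
  have hom: "N (c *\<^sub>R v) = \<bar>c\<bar> * N v" for c v
    using N(1) unfolding absolute_norm_def is_norm_def by blast
  have f_split: "f (a *\<^sub>R u, b *\<^sub>R v) = a * f (u, 0) + b * f (0, v)" for u v
    using f.add[of "a *\<^sub>R (u, 0)" "b *\<^sub>R (0, v)"] f.scaleR[of a "(u, 0)"] f.scaleR[of b "(0, v)"]
    by simp
  define g where "g = f (a *\<^sub>R x, b *\<^sub>R y) - (1 - \<delta>)"
  have g: "0 < g" using z by (simp add: g_def slice_def)
  \<comment> \<open>The total loss is at most \<open>(a + b) * \<eta>\<close>; the extra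
    \<open>1\<close> keeps it strictly below the slack \<open>g\<close> of the given point in the
    slice.\<close>
  define \<eta> where "\<eta> = g / (a + b + 1)"
  have \<eta>: "0 < \<eta>" using g ab by (simp add: \<eta>_def)
  have "(a + b + 1) * \<eta> = g" using ab by (simp add: \<eta>_def)
  with \<eta> have \<eta>g: "a * \<eta> + b * \<eta> < g" by (simp add: algebra_simps)
  obtain u where u: "norm u \<le> 1" "f (u, 0) > f (x, 0) - \<eta>"
    and ux: "a \<noteq> 0 \<Longrightarrow> norm (u - x) > \<alpha> - \<epsilon>"
  proof (cases "a = 0")
    case True
    with that[of x] x \<eta> show ?thesis by simp
  next
    case False
    show ?thesis
      by (rule delta_bound_functional[OF neX x \<alpha>x[OF False]
            dual_sphere_sum_norm_components(1)[OF N f] \<epsilon> \<eta>]) (rule that)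
  qed
  obtain v where v: "norm v \<le> 1" "f (0, v) > f (0, y) - \<eta>"
    and vy: "b \<noteq> 0 \<Longrightarrow> norm (v - y) > \<alpha> - \<epsilon>"
  proof (cases "b = 0")
    case True
    with that[of y] y \<eta> show ?thesis by simp
  next
    case False
    show ?thesis
      by (rule delta_bound_functional[OF neY y \<alpha>y[OF False]
            dual_sphere_sum_norm_components(2)[OF N f] \<epsilon> \<eta>]) (rule that)
  qed
  define w where "w = (a *\<^sub>R u, b *\<^sub>R v)"
  show "\<exists>w\<in>slice (sum_norm N) f \<delta>. sum_norm N (w - (a *\<^sub>R x, b *\<^sub>R y)) > \<alpha> - \<epsilon>"
  proof (intro bexI[of _ w])
    \<comment> \<open>A common lower bound for the distances of the components with nonzero weight.
      Monotonicity and homogeneity of \<open>N\<close> then bound the distance in the sum below by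
      \<open>m * N (a, b) = m\<close>.\<close>
    define m where "m = (if a = 0 then norm (v - y) else if b = 0 then norm (u - x)
      else min (norm (u - x)) (norm (v - y)))"
    \<comment> \<open>At least one component is really moved, so \<open>m\<close> exceeds
      \<open>\<alpha> - \<epsilon>\<close> in each case.\<close>
    have "(a, b) \<noteq> (0, 0)" using ab(3) hom[of 0 "(0, 0)"] by auto
    then have m: "\<alpha> - \<epsilon> < m" "0 \<le> m" using ux vy by (auto simp: m_def)
    have "a * m \<le> a * norm (u - x)" "b * m \<le> b * norm (v - y)"
      using ab by (auto simp: m_def intro: mult_left_mono)
    then have "N (a * m, b * m) \<le> N (a * norm (u - x), b * norm (v - y))"
      using ab m by (intro absolute_norm_mono[OF N(1)]) auto
    also have "N (a * m, b * m) = m" using hom[of m "(a, b)"] ab m by (simp add: mult.commute)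
    also have "N (a * norm (u - x), b * norm (v - y)) = sum_norm N (w - (a *\<^sub>R x, b *\<^sub>R y))"
      using ab by (simp add: sum_norm_def w_def flip: scaleR_diff_right)
    finally show "\<alpha> - \<epsilon> < sum_norm N (w - (a *\<^sub>R x, b *\<^sub>R y))" using m by simp
  next
    have "N (a * norm u, b * norm v) \<le> N (a, b)"
      using ab u v by (intro absolute_norm_mono[OF N(1)]) (auto intro: mult_left_le)
    then have "sum_norm N w \<le> 1" using ab by (simp add: sum_norm_def w_def)
    moreover have "a * (f (x, 0) - \<eta>) + b * (f (0, y) - \<eta>) \<le> a * f (u, 0) + b * f (0, v)"
      using ab u v by (intro add_mono mult_left_mono) auto
    then have "f w > 1 - \<delta>" using \<eta>g unfolding w_def g_def f_split by (simp add: algebra_simps)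
    ultimately show "w \<in> slice (sum_norm N) f \<delta>" by (simp add: slice_def unit_ball_def)
  qed
qed

theorem proposition4p9:
  fixes N :: "real \<times> real \<Rightarrow> real"
    and a b :: real
    and x :: "'a::banach"
    and y :: "'b::banach"
  assumes "(UNIV :: 'a set) \<noteq> {0}"
    and "(UNIV :: 'b set) \<noteq> {0}"
    and "absolute_norm N"
    and "normalized N"
    and "a \<ge> 0"
    and "b \<ge> 0"
    and "N (a, b) = 1"
    and "x \<in> unit_ball norm"
    and "y \<in> unit_ball norm"
  shows "delta_const (sum_norm N) (a *\<^sub>R x, b *\<^sub>R y) \<ge> min (delta_const norm x) (delta_const norm y) \<and>
    (b = 0 \<longrightarrow> delta_const (sum_norm N) (x, 0 :: 'b) \<ge> delta_const norm x) \<and>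
    (a = 0 \<longrightarrow> delta_const (sum_norm N) (0 :: 'a, y) \<ge> delta_const norm y)"
proof -
  have x: "norm x \<le> 1" and y: "norm y \<le> 1" using assms(8,9) by (auto simp: unit_ball_def)
  have "sum_norm N (0 :: 'a \<times> 'b) = 0"
    using is_norm_sum_norm[OF assms(3)] unfolding is_norm_def by blast
  then have nonneg: "0 \<le> delta_const (sum_norm N) z" for z :: "'a \<times> 'b"
    by (rule delta_const_nonneg)
  \<comment> \<open>The three claims are the cases where \<open>d\<close> is the minimum or one of
    the two constants; a zero weight makes the corresponding premise vacuous.\<close>
  have main: "d \<le> delta_const (sum_norm N) (a *\<^sub>R x, b *\<^sub>R y)"
    if "a \<noteq> 0 \<Longrightarrow> d \<le> delta_const norm x" "b \<noteq> 0 \<Longrightarrow> d \<le> delta_const norm y" for d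
  proof (rule ccontr)
    assume "\<not> ?thesis"
    then obtain \<alpha> where \<alpha>: "delta_const (sum_norm N) (a *\<^sub>R x, b *\<^sub>R y) < ereal \<alpha>" "ereal \<alpha> < d"
      using ereal_dense2 by (auto simp: not_le)
    have "delta_bound (sum_norm N) (a *\<^sub>R x, b *\<^sub>R y) \<alpha>"
      using that \<alpha>(2)
      by (intro delta_bound_sum_norm[OF assms(1-7) x y] delta_bound_if_less) (auto intro: less_le_trans)
    \<comment> \<open>The supremum ranges over nonnegative numbers only, so the sign of
      \<open>\<alpha>\<close> must be known.\<close>
    moreover have "0 < ereal \<alpha>" using nonneg \<alpha>(1) by (rule le_less_trans)
    ultimately have "ereal \<alpha> \<le> delta_const (sum_norm N) (a *\<^sub>R x, b *\<^sub>R y)"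
      unfolding delta_const_eq by (intro Sup_upper) auto
    with \<alpha>(1) show False by simp
  qed
  \<comment> \<open>Normalization identifies \<open>(a *\<^sub>R x, b *\<^sub>R y)\<close> with
    \<open>(x, 0)\<close> or \<open>(0, y)\<close> in the last two claims.\<close>
  have "a = 1" if "b = 0"
    using absolute_norm_fst[OF assms(3,4), of a] assms(5,7) that by simp
  moreover have "b = 1" if "a = 0"
    using absolute_norm_snd[OF assms(3,4), of b] assms(6,7) that by simp
  ultimately show ?thesis
    using main[of "min (delta_const norm x) (delta_const norm y)"]
      main[of "delta_const norm x"] main[of "delta_const norm y"] by auto
qed

end
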